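(* Let $d$ be a natural number that is not a perfect square and let $m$ be an integer such that $1\le |m|<\sqrt d$. Let $(v_n)_{n\ge 0}$ be the sequence of positive integers associated with $\sqrt d$ (defined in the context), let $T$ be the minimal period of the continued fraction expansion of $\sqrt d$, and let $\frac{p_n}{q_n}$ be the convergent of index $n$ of this expansion. Let $\mathcal S_{d,m}$ be the set of non-trivial solutions $(x,y)\in\mathbb N^2$ of the equation $$(F_{d,m}):\quad x^2-dy^2=m$$ such that $\gcd(x,y)=1$, and for every $\ell\in\mathbb Z$ let $\mathscr E_\ell:=\{\,j\in\{1,\dots,T\} : (-1)^j v_j=\ell\,\}$. 1. If $T$ is even, then $\mathcal S_{d,m}$ is non-empty if and only if $\mathscr E_m$ is non-empty, and in this case $$\mathcal S_{d,m}=\bigcup_{N\in\mathscr E_m}\{(p_{N+kT-1},\,q_{N+kT-1}) : k\in\mathbb N\}.$$ 2. If $T$ is odd, then $\mathcal S_{d,m}$ is non-empty if and only if at least one of the two sets $\mathscr E_m$, $\mathscr E_{-m}$ is non-empty, and in this case $$\mathcal S_{d,m}=\bigcup_{N\in\mathscr E_m}\{(p_{N+2kT-1},\,q_{N+2kT-1}) : k\in\mathbb N\}\ \cup\ \bigcup_{M\in\mathscr E_{-m}}\{(p_{M+(2k+1)T-1},\,q_{M+(2k+1)T-1}) : k\in\mathbb N\}.$$ 3. In all cases, if $\mathcal S_{d,m}$ is non-empty then $(F_{d,m})$ has infinitely many solutions.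
   Context: $\mathbb N=\{0,1,2,\dots\}$. A solution $(x,y)\in\mathbb N^2$ of $x^2-dy^2=m$ is called trivial if $m$ is a perfect square and $(x,y)=(\sqrt m,0)$; otherwise it is non-trivial. Continued fractions: for an irrational $z$, put $z_0:=z$, $a_n:=\lfloor z_n\rfloor$ and $z_{n+1}:=1/(z_n-a_n)$ for $n\ge0$; the $z_n$ are the complete quotients of $z$, the $a_n$ are its partial quotients, and the continued fraction expansion of $z$ is $z=[a_0,a_1,a_2,\dots]$. The convergent of index $n$ is $[a_0,\dots,a_n]=\frac{p_n}{q_n}$ (in lowest terms), where $p_{-2}=0$, $p_{-1}=1$, $q_{-2}=1$, $q_{-1}=0$ and $p_n=a_np_{n-1}+p_{n-2}$, $q_n=a_nq_{n-1}+q_{n-2}$ for $n\ge 0$. Let $d$ be a natural number that is not a perfect square. The partial quotients $(a_n)$ of $\sqrt d$ are periodic from rank $1$; $T\ge1$ denotes the smallest period. Put $x:=\lfloor\sqrt d\rfloor+\sqrt d$ and let $(x_n)_{n\ge0}$ be the sequence of complete quotients of $x$. The sequences $(u_n)_{n\ge0}$ and $(v_n)_{n\ge0}$ associated with $\sqrt d$ are the (unique) sequences of positive integers such that $x_n=\frac{u_n+\sqrt d}{v_n}$ for all $n\ge0$. Equivalently, $u_0=\lfloor\sqrt d\rfloor$, $v_0=1$ and $u_{n+1}=\lfloor x_n\rfloor v_n-u_n$, $v_{n+1}=\frac{d-u_{n+1}^2}{v_n}$. *)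

theory Defs
  imports Complex_Main
begin

primrec complete_quotient :: "real \<Rightarrow> nat \<Rightarrow> real" where
  "complete_quotient z 0 = z"
| "complete_quotient z (Suc n) =
     1 / (complete_quotient z n - of_int \<lfloor>complete_quotient z n\<rfloor>)"

definition partial_quotient :: "real \<Rightarrow> nat \<Rightarrow> int" where
  "partial_quotient z n = \<lfloor>complete_quotient z n\<rfloor>"

text \<open>The recurrences for $p_n$ and $q_n$ start at index $-2$; the auxiliary functions are
  shifted by two, so that their value at \<open>n\<close> is $p_{n-2}$, respectively $q_{n-2}$.\<close>

fun shifted_num :: "real \<Rightarrow> nat \<Rightarrow> int" where
  "shifted_num z 0 = 0"
| "shifted_num z (Suc 0) = 1"
| "shifted_num z (Suc (Suc n)) =
     partial_quotient z n * shifted_num z (Suc n) + shifted_num z n"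

fun shifted_denom :: "real \<Rightarrow> nat \<Rightarrow> int" where
  "shifted_denom z 0 = 1"
| "shifted_denom z (Suc 0) = 0"
| "shifted_denom z (Suc (Suc n)) =
     partial_quotient z n * shifted_denom z (Suc n) + shifted_denom z n"

definition conv_num :: "real \<Rightarrow> nat \<Rightarrow> int" where
  "conv_num z n = shifted_num z (n + 2)"

definition conv_denom :: "real \<Rightarrow> nat \<Rightarrow> int" where
  "conv_denom z n = shifted_denom z (n + 2)"

definition sqrt_period :: "nat \<Rightarrow> nat" where
  "sqrt_period d = (LEAST T. 1 \<le> T \<and>
     (\<forall>n\<ge>1. partial_quotient (sqrt (real d)) (n + T) = partial_quotient (sqrt (real d)) n))"

text \<open>Note that the complete quotients are those of \<open>\<lfloor>sqrt d\<rfloor> + sqrt d\<close>, not of \<open>sqrt d\<close>.\<close>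

definition sqrt_assoc :: "nat \<Rightarrow> (nat \<Rightarrow> int) \<Rightarrow> (nat \<Rightarrow> int) \<Rightarrow> bool" where
  "sqrt_assoc d u v \<longleftrightarrow> (\<forall>n. 0 < u n \<and> 0 < v n \<and>
     complete_quotient (of_int \<lfloor>sqrt (real d)\<rfloor> + sqrt (real d)) n
       = (of_int (u n) + sqrt (real d)) / of_int (v n))"

definition sqrt_v :: "nat \<Rightarrow> nat \<Rightarrow> int" where
  "sqrt_v d = (THE v. \<exists>u. sqrt_assoc d u v)"

text \<open>Solutions in $\mathbb{N}^2$ are represented as pairs of nonnegative integers.\<close>

definition pell_solutions :: "nat \<Rightarrow> int \<Rightarrow> (int \<times> int) set" where
  "pell_solutions d m = {(x, y). 0 \<le> x \<and> 0 \<le> y \<and> x\<^sup>2 - int d * y\<^sup>2 = m}"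

definition trivial_solution :: "int \<Rightarrow> int \<times> int \<Rightarrow> bool" where
  "trivial_solution m s \<longleftrightarrow> (\<exists>k\<ge>0. m = k\<^sup>2 \<and> s = (k, 0))"

definition primitive_solutions :: "nat \<Rightarrow> int \<Rightarrow> (int \<times> int) set" where
  "primitive_solutions d m =
     {(x, y) \<in> pell_solutions d m. \<not> trivial_solution m (x, y) \<and> gcd x y = 1}"

definition index_set :: "nat \<Rightarrow> int \<Rightarrow> nat set" where
  "index_set d l = {j \<in> {1..sqrt_period d}. (- 1) ^ j * sqrt_v d j = l}"

end

theory Submission
  imports Defs
begin

text \<open>
  Write \<open>D\<close> for the square root of \<open>d\<close>, \<open>P n\<close> and \<open>Q n\<close> for \<open>p\<^sub>n\<^sub>-\<^sub>1\<close> and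
  \<open>q\<^sub>n\<^sub>-\<^sub>1\<close>, and \<open>N(x, y) = x\<^sup>2 - d y\<^sup>2\<close>. The theorem follows from three facts.

  \<^item> A convergent has norm \<open>N(P n, Q n) = (-1)^n V n\<close> (\<open>norm_convergent\<close>).

  \<^item> Every coprime pair \<open>(x, y)\<close> with \<open>x \<ge> 0\<close>, \<open>y > 0\<close> and norm less than \<open>D\<close> in absolute value
    is some \<open>(P n, Q n)\<close> with \<open>n \<ge> 1\<close> (\<open>small_norm_is_convergent\<close>). Consecutive convergents form a
    basis of the lattice of integer pairs, so \<open>(x, y)\<close> is an integer combination of
    \<open>(P n, Q n)\<close> and \<open>(P (n + 1), Q (n + 1))\<close>, where \<open>n\<close> is chosen so that \<open>x + D y\<close> lies
    between the values of \<open>X + D Y\<close> at these two pairs. If the combination is a proper one, the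
    coefficients have opposite signs. Since the conjugates \<open>X - D Y\<close> alternate in sign, this
    makes \<open>\<bar>x - D y\<bar>\<close> at least \<open>\<bar>P n - D Q n\<bar>\<close>. Expressing the nonzero integer
    \<open>y P n - x Q n\<close> through \<open>X + D Y\<close> and \<open>X - D Y\<close> then gives \<open>\<bar>N(x, y)\<bar> \<ge> D\<close>.
    Using \<open>X + D Y\<close> as the measure of size treats positive and negative norms alike.

  \<^item> From \<open>n = 1\<close> on, \<open>V\<close> has the period \<open>T\<close> of the partial quotients (\<open>V_period\<close>).
    That a period exists at all is a pigeonhole argument: the pairs \<open>(U n, V n)\<close> are bounded, and
    the map from one to the next is injective (\<open>surd_step_inj\<close>). That the minimal period of the
    partial quotients is also one of \<open>V\<close> holds because the partial quotients determine the
    number (\<open>partial_quotients_determine\<close>).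

  By the first two facts the primitive solutions are exactly the pairs \<open>(P n, Q n)\<close> with
  \<open>n \<ge> 1\<close> and \<open>(-1)^n V n = m\<close>. Writing \<open>n = N + k T\<close> with \<open>1 \<le> N \<le> T\<close> leaves
  \<open>V n = V N\<close>, while the sign is multiplied by \<open>(-1)^(k T)\<close>: it does not change
  when \<open>T\<close> is even, and it changes with the parity of \<open>k\<close> when \<open>T\<close> is odd. Shifting \<open>n\<close> by
  multiples of \<open>2 T\<close> yields infinitely many solutions from one.
\<close>

section \<open>Complete quotients of irrational numbers\<close>

lemma complete_quotient_irrational:
  assumes "z \<notin> \<rat>"
  shows "complete_quotient z n \<notin> \<rat>"
proof (induction n)
  case 0
  then show ?case using assms by simp
next
  case (Suc n)
  let ?c = "complete_quotient z n"
  have "?c = 1 / complete_quotient z (Suc n) + of_int \<lfloor>?c\<rfloor>"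
    by simp
  then show ?case
    using Suc by (metis Rats_1 Rats_add Rats_divide Rats_of_int)
qed

lemma complete_quotient_Suc_gt_1:
  assumes "z \<notin> \<rat>"
  shows "1 < complete_quotient z (Suc n)"
proof -
  let ?c = "complete_quotient z n"
  have "?c \<noteq> of_int \<lfloor>?c\<rfloor>"
    using complete_quotient_irrational[OF assms, of n] by (metis Rats_of_int)
  then have "0 < ?c - of_int \<lfloor>?c\<rfloor>" "?c - of_int \<lfloor>?c\<rfloor> < 1"
    by linarith+
  then show ?thesis by (simp add: less_divide_eq)
qed

lemma complete_quotient_unfold:
  "complete_quotient z n = of_int (partial_quotient z n) + 1 / complete_quotient z (Suc n)"
  by (simp add: partial_quotient_def)

lemma partial_quotient_Suc_ge_1:
  assumes "z \<notin> \<rat>"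
  shows "1 \<le> partial_quotient z (Suc n)"
  using complete_quotient_Suc_gt_1[OF assms, of n] unfolding partial_quotient_def by linarith

text \<open>A single complete quotient may be arbitrarily close to 1, but then the next one is large:
  with \<open>z\<^sub>n = a\<^sub>n + 1 / z\<^sub>n\<^sub>+\<^sub>1\<close>, the product \<open>z\<^sub>n z\<^sub>n\<^sub>+\<^sub>1\<close> is \<open>a\<^sub>n z\<^sub>n\<^sub>+\<^sub>1 + 1\<close>.\<close>

lemma complete_quotient_product_gt_2:
  assumes "z \<notin> \<rat>"
  shows "2 < complete_quotient z (Suc n) * complete_quotient z (Suc (Suc n))"
proof -
  let ?b = "complete_quotient z (Suc (Suc n))"
  have b: "1 < ?b" by (rule complete_quotient_Suc_gt_1[OF assms])
  have "complete_quotient z (Suc n) * ?b = of_int (partial_quotient z (Suc n)) * ?b + 1"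
    using complete_quotient_unfold[of z "Suc n"] b
    by (simp add: distrib_right del: complete_quotient.simps)
  moreover have "1 * ?b \<le> of_int (partial_quotient z (Suc n)) * ?b"
    using partial_quotient_Suc_ge_1[OF assms, of n] b by (intro mult_right_mono) auto
  ultimately show ?thesis using b by linarith
qed

lemma complete_quotient_add:
  "complete_quotient z (m + n) = complete_quotient (complete_quotient z m) n"
  by (induction n) simp_all

lemma partial_quotient_add:
  "partial_quotient z (m + n) = partial_quotient (complete_quotient z m) n"
  by (simp add: partial_quotient_def complete_quotient_add)

lemma complete_quotient_diff_Suc:
  assumes "z \<notin> \<rat>" "w \<notin> \<rat>" "partial_quotient z n = partial_quotient w n"
  shows "\<bar>complete_quotient z (Suc n) - complete_quotient w (Suc n)\<bar> =
    \<bar>complete_quotient z n - complete_quotient w n\<bar> *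
      (complete_quotient z (Suc n) * complete_quotient w (Suc n))"
proof -
  let ?a = "complete_quotient z (Suc n)" and ?b = "complete_quotient w (Suc n)"
  have a: "1 < ?a" and b: "1 < ?b"
    using assms complete_quotient_Suc_gt_1 by blast+
  have "complete_quotient z n - complete_quotient w n = 1 / ?a - 1 / ?b"
    using complete_quotient_unfold[of z n] complete_quotient_unfold[of w n]
      assms(3) by linarith
  also have "\<dots> = (?b - ?a) / (?a * ?b)"
    using a b by (simp add: divide_simps del: complete_quotient.simps)
  finally show ?thesis using a b
    by (simp add: abs_mult abs_divide abs_minus_commute del: complete_quotient.simps)
qed

text \<open>Two numbers with the same partial quotients have complete quotients whose distance grows
  by a factor of at least 4 every second step, yet complete quotients with equal integer parts
  are less than 1 apart.\<close>

lemma partial_quotients_determine: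
  assumes z: "z \<notin> \<rat>" and w: "w \<notin> \<rat>"
    and eq: "\<And>n. partial_quotient z n = partial_quotient w n"
  shows "z = w"
proof (rule ccontr)
  assume "z \<noteq> w"
  define \<delta> where "\<delta> n = \<bar>complete_quotient z n - complete_quotient w n\<bar>" for n
  have pos: "0 < \<delta> 0" using \<open>z \<noteq> w\<close> by (simp add: \<delta>_def)
  have lt1: "\<delta> n < 1" for n
    using eq[of n] unfolding \<delta>_def partial_quotient_def by linarith
  have step: "4 * \<delta> n \<le> \<delta> (Suc (Suc n))" for n
  proof -
    let ?a = "complete_quotient z (Suc n)" and ?b = "complete_quotient w (Suc n)"
    let ?a' = "complete_quotient z (Suc (Suc n))" and ?b' = "complete_quotient w (Suc (Suc n))"
    have "\<delta> (Suc (Suc n)) = \<delta> n * (?a * ?b) * (?a' * ?b')"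
      using complete_quotient_diff_Suc[OF z w eq[of n]]
        complete_quotient_diff_Suc[OF z w eq[of "Suc n"]]
      by (simp only: \<delta>_def)
    also have "\<dots> = \<delta> n * ((?a * ?a') * (?b * ?b'))" by (simp only: ac_simps)
    finally have "\<delta> (Suc (Suc n)) = \<delta> n * ((?a * ?a') * (?b * ?b'))" .
    moreover have "2 * 2 \<le> (?a * ?a') * (?b * ?b')"
      using complete_quotient_product_gt_2[OF z, of n] complete_quotient_product_gt_2[OF w, of n]
      by (intro mult_mono) (simp_all only: less_imp_le)
    moreover have "0 \<le> \<delta> n" by (simp add: \<delta>_def)
    ultimately show ?thesis
      by (simp add: mult_left_mono mult.commute del: complete_quotient.simps)
  qed
  have grow: "4 ^ k * \<delta> 0 \<le> \<delta> (2 * k)" for k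
  proof (induction k)
    case (Suc k)
    have "4 ^ Suc k * \<delta> 0 \<le> 4 * \<delta> (2 * k)" using Suc by simp
    also have "\<dots> \<le> \<delta> (2 * Suc k)" using step[of "2 * k"] by simp
    finally show ?case .
  qed simp
  obtain k where "1 / \<delta> 0 < 4 ^ k"
    using real_arch_pow[of 4 "1 / \<delta> 0"] by auto
  then have "1 < 4 ^ k * \<delta> 0" using pos by (simp add: divide_less_eq)
  with grow[of k] lt1[of "2 * k"] show False by linarith
qed

section \<open>Reduced quadratic irrationals\<close>

locale nonsquare =
  fixes d :: nat
  assumes nonsquare: "\<nexists>k::nat. d = k\<^sup>2"
begin

abbreviation D :: real where "D \<equiv> sqrt (real d)"

lemma D_irrational: "D \<notin> \<rat>"
proof
  assume "D \<in> \<rat>"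
  then obtain m n where n: "n \<noteq> 0" and eq: "\<bar>D\<bar> = real m / real n" and co: "coprime m n"
    by (rule Rats_abs_nat_div_natE)
  have "real m = D * real n" using n eq by (simp add: field_simps)
  then have "real (m\<^sup>2) = real (d * n\<^sup>2)"
    by (simp add: power_mult_distrib)
  then have "m\<^sup>2 = d * n\<^sup>2" by (simp only: of_nat_eq_iff)
  then have "n\<^sup>2 dvd m\<^sup>2" by simp
  moreover have "coprime (n\<^sup>2) (m\<^sup>2)" using co by (simp add: coprime_commute)
  ultimately have "n\<^sup>2 = 1" by (metis coprime_absorb_left nat_dvd_1_iff_1)
  with \<open>m\<^sup>2 = d * n\<^sup>2\<close> nonsquare show False by auto
qed

lemma D_gt_1: "1 < D"
proof -
  have "d \<noteq> 0\<^sup>2" "d \<noteq> 1\<^sup>2" using nonsquare by blast+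
  then have "1 < d" by simp
  then show ?thesis by simp
qed

lemma int_combination_eq_0:
  assumes "of_int a + of_int b * D = 0"
  shows "a = 0 \<and> b = 0"
proof (cases "b = 0")
  case False
  then have "D = - of_int a / of_int b" using assms by (simp add: field_simps)
  then have "D \<in> \<rat>" by simp
  with D_irrational show ?thesis by blast
qed (use assms in simp)

lemma surd_form_unique:
  assumes "(of_int u + D) / of_int v = (of_int u' + D) / of_int v'" "0 < v" "0 < v'"
  shows "u = u' \<and> v = v'"
proof -
  have "(of_int u + D) * of_int v' = (of_int u' + D) * of_int v"
    using assms by (simp add: frac_eq_eq)
  then have "of_int (u * v' - u' * v) + of_int (v' - v) * D = 0"
    by (simp add: algebra_simps)
  then have "u * v' - u' * v = 0 \<and> v' - v = 0" by (rule int_combination_eq_0)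
  then show ?thesis using assms by auto
qed

text \<open>The inequalities after \<open>0 < v\<close> say that \<open>(u + D) / v > 1\<close> and that its conjugate lies between
  \<open>-1\<close> and \<open>0\<close>.\<close>

definition reduced :: "int \<Rightarrow> int \<Rightarrow> bool" where
  "reduced u v \<longleftrightarrow> 0 < v \<and> of_int u < D \<and> D - of_int u < of_int v \<and> of_int v < D + of_int u \<and>
     v dvd int d - u\<^sup>2"

text \<open>The passage from \<open>(u\<^sub>n, v\<^sub>n)\<close> to \<open>(u\<^sub>n\<^sub>+\<^sub>1, v\<^sub>n\<^sub>+\<^sub>1)\<close>; on reduced pairs the division by
  \<open>v\<close> is exact.\<close>

definition surd_step :: "int \<times> int \<Rightarrow> int \<times> int" where
  "surd_step s = (let (u, v) = s; u' = \<lfloor>(of_int u + D) / of_int v\<rfloor> * v - u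
                  in (u', (int d - u'\<^sup>2) div v))"

lemma reduced_pos: "reduced u v \<Longrightarrow> 0 < u \<and> 0 < v"
  unfolding reduced_def by linarith

text \<open>Everything rests on \<open>v v' = (D - u') (D + u')\<close>. Subtracting the integer part gives
  \<open>0 < D - u' < v < D + u'\<close>, and comparing the product with these bounds gives
  \<open>D - u' < v' < D + u'\<close>.\<close>

lemma reduced_step:
  assumes red: "reduced u v" and step: "surd_step (u, v) = (u', v')"
  shows "reduced u' v'" and "v * v' = int d - u'\<^sup>2"
    and "u' = \<lfloor>(of_int u + D) / of_int v\<rfloor> * v - u"
    and "1 / ((of_int u + D) / of_int v - of_int \<lfloor>(of_int u + D) / of_int v\<rfloor>) =
      (of_int u' + D) / of_int v'"
proof -
  define A where "A = \<lfloor>(of_int u + D) / of_int v\<rfloor>"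
  have u': "u' = A * v - u" and v': "v' = (int d - u'\<^sup>2) div v"
    using step by (auto simp: surd_step_def A_def Let_def)
  show "u' = \<lfloor>(of_int u + D) / of_int v\<rfloor> * v - u" using u' A_def by simp
  have v: "0 < v" and r: "of_int u < D" "D - of_int u < of_int v" "of_int v < D + of_int u"
    and dv: "v dvd int d - u\<^sup>2"
    using red by (auto simp: reduced_def)
  have "of_int A \<le> (of_int u + D) / of_int v" "(of_int u + D) / of_int v < of_int A + 1"
    unfolding A_def by linarith+
  then have lo: "of_int A * of_int v \<le> of_int u + D"
    and hi: "of_int u + D < (of_int A + 1) * of_int v"
    using v by (simp_all add: field_simps)
  have "(1::real) \<le> (of_int u + D) / of_int v" using r v by (simp add: le_divide_eq)
  then have A1: "1 \<le> A" unfolding A_def by linarith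
  have ru': "(of_int u' :: real) = of_int A * of_int v - of_int u" using u' by simp
  have "int d - u'\<^sup>2 = (int d - u\<^sup>2) + v * (2 * A * u - A\<^sup>2 * v)"
    unfolding u' by (simp add: power2_eq_square algebra_simps)
  moreover have "v dvd (int d - u\<^sup>2) + v * (2 * A * u - A\<^sup>2 * v)"
    using dv by (intro dvd_add) simp_all
  ultimately have dv': "v dvd int d - u'\<^sup>2" by (simp only:)
  then show vv': "v * v' = int d - u'\<^sup>2" unfolding v' by simp
  have "of_int u' \<noteq> D" using D_irrational by (metis Rats_of_int)
  then have lt: "of_int u' < D" using lo ru' by linarith
  have lt2: "D - of_int u' < of_int v" using hi ru' by (simp add: algebra_simps)
  have "1 * v \<le> A * v" using A1 v by (intro mult_right_mono) auto
  then have "v \<le> u + u'" using u' by simp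
  then have lt3: "of_int v < D + of_int u'" using r by linarith
  have prod: "of_int v * of_int v' = (D - of_int u') * (D + of_int u')"
  proof -
    have "of_int v * of_int v' = (of_int (int d - u'\<^sup>2) :: real)"
      by (simp only: vv'[symmetric] of_int_mult)
    then show ?thesis by (simp add: algebra_simps power2_eq_square)
  qed
  have pos: "0 < D - of_int u'" "0 < D + of_int u'" "0 < (of_int v :: real)"
    using lt lt3 v by (auto intro: less_trans)
  have "0 < of_int v * (of_int v' :: real)" unfolding prod using pos by simp
  then have v'0: "0 < (of_int v' :: real)" using pos zero_less_mult_pos by blast
  have "D - of_int u' < of_int v'"
  proof (rule ccontr)
    assume "\<not> ?thesis"
    then have "of_int v * of_int v' \<le> of_int v * (D - of_int u')"
      using pos by (intro mult_left_mono) auto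
    also have "\<dots> < (D + of_int u') * (D - of_int u')"
      using pos lt3 by (intro mult_strict_right_mono) auto
    finally show False using prod by (simp add: mult.commute)
  qed
  moreover have "of_int v' < D + of_int u'"
  proof (rule ccontr)
    assume "\<not> ?thesis"
    then have "(D - of_int u') * (D + of_int u') \<le> (D - of_int u') * of_int v'"
      using pos by (intro mult_left_mono) auto
    also have "\<dots> < of_int v * of_int v'"
      using lt2 v'0 by (intro mult_strict_right_mono) auto
    finally show False using prod by simp
  qed
  moreover have "v' dvd int d - u'\<^sup>2" using vv' by (metis dvd_triv_right)
  ultimately show "reduced u' v'" using lt v'0 by (auto simp: reduced_def)
  have "(of_int u + D) / of_int v - of_int A = (D - of_int u') / of_int v"
    using pos ru' by (simp add: field_simps)
  moreover have "of_int v / (D - of_int u') = (of_int u' + D) / of_int v'"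
    using prod pos v'0 by (simp add: frac_eq_eq mult.commute add.commute)
  ultimately show "1 / ((of_int u + D) / of_int v - of_int \<lfloor>(of_int u + D) / of_int v\<rfloor>) =
      (of_int u' + D) / of_int v'"
    by (simp flip: A_def)
qed

text \<open>A step can be undone: \<open>v\<close> is \<open>(d - u'\<^sup>2) / v'\<close>, and \<open>u\<close> is then
  known modulo \<open>v\<close> and lies in the interval from \<open>D - v\<close> to \<open>D\<close>. This is what makes
  the expansion periodic without a preperiod.\<close>

lemma surd_step_inj:
  assumes "reduced u1 v1" "reduced u2 v2" "surd_step (u1, v1) = surd_step (u2, v2)"
  shows "u1 = u2 \<and> v1 = v2"
proof -
  obtain u' v' where s1: "surd_step (u1, v1) = (u', v')" by (metis surj_pair)
  then have s2: "surd_step (u2, v2) = (u', v')" using assms by simp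
  note r1 = reduced_step[OF assms(1) s1] and r2 = reduced_step[OF assms(2) s2]
  have "v' > 0" using r1(1) by (simp add: reduced_def)
  have v: "v1 = v2" using r1(2) r2(2) \<open>v' > 0\<close> by (metis mult_right_cancel less_irrefl)
  obtain A1 A2 where "u' = A1 * v1 - u1" "u' = A2 * v1 - u2"
    using r1(3) r2(3) v by blast
  then have "u1 - u2 = (A1 - A2) * v1" by (simp add: algebra_simps)
  moreover have "\<bar>u1 - u2\<bar> < v1" using assms(1,2) v unfolding reduced_def by linarith
  ultimately have "u1 - u2 = 0"
    by (metis dvd_triv_right zdvd_not_zless zero_less_abs_iff dvd_abs_iff)
  then show ?thesis using v by simp
qed

section \<open>The associated sequences and the period\<close>

definition surd_state :: "nat \<Rightarrow> int \<times> int" where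
  "surd_state n = (surd_step ^^ n) (\<lfloor>D\<rfloor>, 1)"

definition U :: "nat \<Rightarrow> int" where "U n = fst (surd_state n)"
definition V :: "nat \<Rightarrow> int" where "V n = snd (surd_state n)"

lemma U_0: "U 0 = \<lfloor>D\<rfloor>" and V_0: "V 0 = 1"
  by (simp_all add: U_def V_def surd_state_def)

lemma surd_step_UV: "surd_step (U n, V n) = (U (Suc n), V (Suc n))"
  by (simp add: U_def V_def surd_state_def)

lemma reduced_UV: "reduced (U n) (V n)"
proof (induction n)
  case 0
  have "of_int \<lfloor>D\<rfloor> \<noteq> D" using D_irrational by (metis Rats_of_int)
  moreover have "1 \<le> \<lfloor>D\<rfloor>" using D_gt_1 by linarith
  ultimately have "of_int \<lfloor>D\<rfloor> < D" "D - of_int \<lfloor>D\<rfloor> < 1" "1 < D + of_int \<lfloor>D\<rfloor>"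
    using D_gt_1 by linarith+
  then show ?case unfolding reduced_def U_0 V_0 by simp
next
  case (Suc n)
  then show ?case using reduced_step(1) surd_step_UV by blast
qed

abbreviation x0 :: real where "x0 \<equiv> of_int \<lfloor>D\<rfloor> + D"

lemma complete_quotient_x0: "complete_quotient x0 n = (of_int (U n) + D) / of_int (V n)"
proof (induction n)
  case 0
  then show ?case by (simp add: U_0 V_0)
next
  case (Suc n)
  then show ?case using reduced_step(4)[OF reduced_UV surd_step_UV] by simp
qed

lemma sqrt_v_eq_V: "sqrt_v d = V"
proof -
  have "sqrt_assoc d U V"
    unfolding sqrt_assoc_def using complete_quotient_x0 reduced_pos[OF reduced_UV] by simp
  moreover have "v = V" if "sqrt_assoc d u v" for u v
  proof
    fix n
    show "v n = V n"
      using that complete_quotient_x0[of n] reduced_pos[OF reduced_UV[of n]] surd_form_unique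
      unfolding sqrt_assoc_def by metis
  qed
  ultimately show ?thesis unfolding sqrt_v_def by (intro the_equality) blast+
qed

lemma complete_quotient_D:
  "complete_quotient D (Suc n) = (of_int (U (Suc n)) + D) / of_int (V (Suc n))"
proof -
  have "complete_quotient D (Suc n) = complete_quotient x0 (Suc n)"
    by (induction n) simp_all
  then show ?thesis by (simp only: complete_quotient_x0)
qed

text \<open>These recurrences hold for the partial quotients of \<open>D\<close> itself, whose expansion differs
  from that of \<open>x0\<close> only at rank 0; hence the indices start at 1.\<close>

lemma UV_step:
  shows "V n * V (Suc n) = int d - (U (Suc n))\<^sup>2"
    and "U (Suc (Suc n)) = partial_quotient D (Suc n) * V (Suc n) - U (Suc n)"
proof -
  show "V n * V (Suc n) = int d - (U (Suc n))\<^sup>2"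
    using reduced_step(2)[OF reduced_UV surd_step_UV] .
  show "U (Suc (Suc n)) = partial_quotient D (Suc n) * V (Suc n) - U (Suc n)"
    unfolding partial_quotient_def complete_quotient_D
    using reduced_step(3)[OF reduced_UV surd_step_UV] .
qed

lemma surd_state_cancel:
  assumes "surd_state (m + k) = surd_state (n + k)"
  shows "surd_state m = surd_state n"
  using assms
proof (induction k)
  case (Suc k)
  have "surd_step (U (m + k), V (m + k)) = surd_step (U (n + k), V (n + k))"
    using Suc.prems by (simp add: U_def V_def surd_state_def)
  then have "U (m + k) = U (n + k) \<and> V (m + k) = V (n + k)"
    by (rule surd_step_inj[OF reduced_UV reduced_UV])
  then show ?case using Suc.IH by (simp add: U_def V_def prod_eq_iff)
qed simp

text \<open>The states lie in a finite set, so two of them coincide; stepping back from the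
  coincidence shows that state 0 recurs.\<close>

lemma surd_state_periodic: "\<exists>T\<ge>1. \<forall>n. surd_state (n + T) = surd_state n"
proof -
  have "surd_state n \<in> {0..\<lceil>D\<rceil>} \<times> {0..2 * \<lceil>D\<rceil>}" for n
  proof -
    have "0 < U n" "0 < V n" "of_int (U n) < D" "of_int (V n) < D + of_int (U n)"
      using reduced_UV[of n] reduced_pos[OF reduced_UV[of n]] by (simp_all only: reduced_def)
    then have "0 \<le> U n" "0 \<le> V n" "U n \<le> \<lceil>D\<rceil>" "V n \<le> 2 * \<lceil>D\<rceil>" by linarith+
    then show ?thesis by (auto simp: U_def V_def mem_Times_iff)
  qed
  then have "range surd_state \<subseteq> {0..\<lceil>D\<rceil>} \<times> {0..2 * \<lceil>D\<rceil>}"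
    by (rule image_subsetI)
  then have "finite (range surd_state)"
    by (rule finite_subset) simp
  then have "\<not> inj surd_state" using finite_imageD[of surd_state UNIV] infinite_UNIV_nat by blast
  then obtain k l where "k \<noteq> l" "surd_state k = surd_state l"
    unfolding inj_on_def by blast
  then obtain i j where "i < j" and eq: "surd_state i = surd_state j"
    by (cases k l rule: linorder_cases) (auto dest: sym)
  have "surd_state (0 + i) = surd_state ((j - i) + i)" using eq \<open>i < j\<close> by simp
  then have start: "surd_state 0 = surd_state (j - i)" by (rule surd_state_cancel)
  have add: "surd_state (n + k) = (surd_step ^^ n) (surd_state k)" for n k
    by (simp add: surd_state_def funpow_add)
  have "surd_state (n + (j - i)) = surd_state n" for n
    using add[of n "j - i"] add[of n 0] by (simp flip: start)
  then show ?thesis using \<open>i < j\<close> by (intro exI[of _ "j - i"]) auto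
qed

lemma sqrt_period_spec:
  shows sqrt_period_ge_1: "1 \<le> sqrt_period d"
    and partial_quotient_period: "\<And>n. 1 \<le> n \<Longrightarrow>
      partial_quotient D (n + sqrt_period d) = partial_quotient D n"
proof -
  let ?P = "\<lambda>T. 1 \<le> T \<and> (\<forall>n\<ge>1. partial_quotient D (n + T) = partial_quotient D n)"
  obtain T where T: "1 \<le> T" "\<And>n. surd_state (n + T) = surd_state n"
    using surd_state_periodic by blast
  have "partial_quotient D (n + T) = partial_quotient D n" if "1 \<le> n" for n
  proof -
    obtain k where "n = Suc k" using \<open>1 \<le> n\<close> by (cases n) auto
    then show ?thesis using T(2)[of n]
      unfolding partial_quotient_def by (simp add: complete_quotient_D U_def V_def
          del: complete_quotient.simps)
  qed
  with T have "?P T" by blast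
  then have "?P (sqrt_period d)" unfolding sqrt_period_def by (rule LeastI)
  then show "1 \<le> sqrt_period d"
    "\<And>n. 1 \<le> n \<Longrightarrow> partial_quotient D (n + sqrt_period d) = partial_quotient D n"
    by blast+
qed

text \<open>The complete quotients of rank \<open>n\<close> and \<open>n + T\<close> have the same partial quotients, hence
  are equal, and \<open>(U n, V n)\<close> can be read off from the complete quotient because \<open>D\<close> is
  irrational.\<close>

lemma V_period:
  assumes "1 \<le> n"
  shows "V (n + sqrt_period d) = V n"
proof -
  let ?z = "complete_quotient D n" and ?w = "complete_quotient D (n + sqrt_period d)"
  have "?z = ?w"
  proof (rule partial_quotients_determine)
    show "?z \<notin> \<rat>" "?w \<notin> \<rat>" using complete_quotient_irrational[OF D_irrational] by auto
    fix k
    show "partial_quotient ?z k = partial_quotient ?w k"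
      using partial_quotient_period[of "n + k"] assms
      by (simp add: ac_simps flip: partial_quotient_add)
  qed
  moreover obtain k where n: "n = Suc k" using assms by (cases n) auto
  ultimately have "(of_int (U n) + D) / of_int (V n) =
      (of_int (U (n + sqrt_period d)) + D) / of_int (V (n + sqrt_period d))"
    using complete_quotient_D[of k] complete_quotient_D[of "k + sqrt_period d"]
    by (simp del: complete_quotient.simps)
  then show ?thesis
    using surd_form_unique reduced_pos[OF reduced_UV] by metis
qed

lemma V_period_mult:
  assumes "1 \<le> n"
  shows "V (n + k * sqrt_period d) = V n"
proof (induction k)
  case (Suc k)
  have "V (n + k * sqrt_period d + sqrt_period d) = V (n + k * sqrt_period d)"
    using assms by (intro V_period) simp
  then show ?case using Suc by (simp add: ac_simps)
qed simp

section \<open>Norms of convergents\<close>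

text \<open>The index is shifted by one against the usual \<open>p\<^sub>n\<close>, \<open>q\<^sub>n\<close>, so that \<open>n = 0\<close> is the
  formal convergent \<open>1 / 0\<close> and the norm of index \<open>n\<close> matches \<open>V n\<close>.\<close>

definition P :: "nat \<Rightarrow> int" where "P n = shifted_num D (Suc n)"
definition Q :: "nat \<Rightarrow> int" where "Q n = shifted_denom D (Suc n)"

lemma P_0: "P 0 = 1" and P_1: "P (Suc 0) = \<lfloor>D\<rfloor>"
  and P_rec: "P (Suc (Suc n)) = partial_quotient D (Suc n) * P (Suc n) + P n"
  by (simp_all add: P_def partial_quotient_def)

lemma Q_0: "Q 0 = 0" and Q_1: "Q (Suc 0) = 1"
  and Q_rec: "Q (Suc (Suc n)) = partial_quotient D (Suc n) * Q (Suc n) + Q n"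
  by (simp_all add: Q_def partial_quotient_def)

lemma PQ_det: "P (Suc n) * Q n - P n * Q (Suc n) = (-1) ^ Suc n"
  by (induction n) (simp_all add: P_0 P_1 P_rec Q_0 Q_1 Q_rec algebra_simps)

lemma floor_D_ge_1: "1 \<le> \<lfloor>D\<rfloor>"
  using D_gt_1 by linarith

lemma PQ_pos: "0 < P n \<and> 0 \<le> Q n \<and> 0 < P (Suc n) \<and> 0 < Q (Suc n)"
proof (induction n)
  case 0
  then show ?case using floor_D_ge_1 by (simp add: P_0 P_1 Q_0 Q_1)
next
  case (Suc n)
  then show ?case using partial_quotient_Suc_ge_1[OF D_irrational, of n]
    by (simp add: P_rec Q_rec add_pos_pos add_pos_nonneg)
qed

lemma U_1: "U (Suc 0) = \<lfloor>D\<rfloor>"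
proof -
  have "\<lfloor>of_int \<lfloor>D\<rfloor> + D\<rfloor> = 2 * \<lfloor>D\<rfloor>" by linarith
  then show ?thesis
    using reduced_step(3)[OF reduced_UV surd_step_UV, of 0] by (simp add: U_0 V_0)
qed

text \<open>The norms satisfy a recurrence only together with the mixed products of consecutive
  convergents, which is where \<open>U\<close> comes in.\<close>

lemma norm_convergent_aux:
  "(P n)\<^sup>2 - int d * (Q n)\<^sup>2 = (-1) ^ n * V n \<and>
   (P (Suc n))\<^sup>2 - int d * (Q (Suc n))\<^sup>2 = (-1) ^ Suc n * V (Suc n) \<and>
   P (Suc n) * P n - int d * (Q (Suc n) * Q n) = (-1) ^ n * U (Suc n)"
proof (induction n)
  case 0
  have "V (Suc 0) = int d - \<lfloor>D\<rfloor>\<^sup>2" using UV_step(1)[of 0] by (simp add: V_0 U_1)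
  then show ?case by (simp add: P_0 P_1 Q_0 Q_1 V_0 U_1)
next
  case (Suc n)
  define A where "A = partial_quotient D (Suc n)"
  define \<epsilon> :: int where "\<epsilon> = (-1) ^ n"
  have N0: "(P n)\<^sup>2 - int d * (Q n)\<^sup>2 = \<epsilon> * V n"
    and N1: "(P (Suc n))\<^sup>2 - int d * (Q (Suc n))\<^sup>2 = - \<epsilon> * V (Suc n)"
    and B: "P (Suc n) * P n - int d * (Q (Suc n) * Q n) = \<epsilon> * U (Suc n)"
    using Suc by (simp_all add: \<epsilon>_def)
  have U2: "U (Suc (Suc n)) = A * V (Suc n) - U (Suc n)" using UV_step(2) A_def by simp
  have "V (Suc n) * V (Suc (Suc n)) = V (Suc n) * (V n + A * (2 * U (Suc n) - A * V (Suc n)))"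
    using UV_step(1)[of n] UV_step(1)[of "Suc n"] unfolding U2
    by (simp add: algebra_simps power2_eq_square)
  then have V2: "V (Suc (Suc n)) = V n + A * (2 * U (Suc n) - A * V (Suc n))"
    using reduced_pos[OF reduced_UV[of "Suc n"]] by simp
  have "P (Suc (Suc n)) * P (Suc n) - int d * (Q (Suc (Suc n)) * Q (Suc n)) =
      A * ((P (Suc n))\<^sup>2 - int d * (Q (Suc n))\<^sup>2) +
      (P (Suc n) * P n - int d * (Q (Suc n) * Q n))"
    by (simp add: P_rec Q_rec A_def algebra_simps power2_eq_square)
  also have "\<dots> = - \<epsilon> * U (Suc (Suc n))"
    unfolding N1 B U2 by (simp add: algebra_simps)
  finally have B': "P (Suc (Suc n)) * P (Suc n) - int d * (Q (Suc (Suc n)) * Q (Suc n)) =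
      - \<epsilon> * U (Suc (Suc n))" .
  have "(P (Suc (Suc n)))\<^sup>2 - int d * (Q (Suc (Suc n)))\<^sup>2 =
      A\<^sup>2 * ((P (Suc n))\<^sup>2 - int d * (Q (Suc n))\<^sup>2) +
      2 * A * (P (Suc n) * P n - int d * (Q (Suc n) * Q n)) + ((P n)\<^sup>2 - int d * (Q n)\<^sup>2)"
    by (simp add: P_rec Q_rec A_def algebra_simps power2_eq_square)
  also have "\<dots> = \<epsilon> * V (Suc (Suc n))"
    unfolding N0 N1 B V2 by (simp add: algebra_simps power2_eq_square)
  finally show ?case using N1 B' by (simp add: \<epsilon>_def)
qed

lemma norm_convergent: "(P n)\<^sup>2 - int d * (Q n)\<^sup>2 = (-1) ^ n * V n"
  using norm_convergent_aux by blast

section \<open>Solutions of small norm are convergents\<close>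

text \<open>\<open>W n\<close> measures the size of a convergent in \<open>\<int>[D]\<close>, and \<open>\<theta> n\<close> is its conjugate.\<close>

definition W :: "nat \<Rightarrow> real" where "W n = of_int (P n) + D * of_int (Q n)"
definition \<theta> :: "nat \<Rightarrow> real" where "\<theta> n = of_int (P n) - D * of_int (Q n)"

lemma W_step: "W n + 1 \<le> W (Suc n)"
proof (cases n)
  case 0
  have "W 0 = 1" "W (Suc 0) = of_int \<lfloor>D\<rfloor> + D" by (simp_all add: W_def P_0 P_1 Q_0 Q_1)
  then show ?thesis unfolding 0 using floor_D_ge_1 D_gt_1 by linarith
next
  case (Suc k)
  have PQ: "0 < P k" "0 \<le> Q k" "0 < P (Suc k)" "0 < Q (Suc k)" using PQ_pos by blast+
  then have W: "1 \<le> W k" "0 \<le> W (Suc k)"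
    using D_gt_1 by (auto simp: W_def intro!: add_increasing2 add_nonneg_nonneg)
  have "1 * W (Suc k) \<le> of_int (partial_quotient D (Suc k)) * W (Suc k)"
    using partial_quotient_Suc_ge_1[OF D_irrational, of k] W by (intro mult_right_mono) auto
  moreover have "W (Suc (Suc k)) = of_int (partial_quotient D (Suc k)) * W (Suc k) + W k"
    by (simp add: W_def P_rec Q_rec algebra_simps)
  ultimately show ?thesis using W Suc by simp
qed

lemma W_ge: "real n + 1 \<le> W n"
proof (induction n)
  case 0
  then show ?case by (simp add: W_def P_0 Q_0)
next
  case (Suc n)
  then show ?case using W_step[of n] by simp
qed

lemma W_strict_mono: "strict_mono W"
  unfolding strict_mono_Suc_iff using W_step by (metis less_add_one less_le_trans)

lemma \<theta>_step: "\<theta> (Suc n) * complete_quotient D (Suc n) = - \<theta> n"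
proof (induction n)
  case 0
  have "D - of_int \<lfloor>D\<rfloor> \<noteq> 0" using D_irrational
    by (metis Rats_of_int right_minus_eq)
  then show ?case by (simp add: \<theta>_def P_0 P_1 Q_0 Q_1 field_simps)
next
  case (Suc n)
  let ?c = "complete_quotient D (Suc n)" and ?c' = "complete_quotient D (Suc (Suc n))"
  have c': "1 < ?c'" by (rule complete_quotient_Suc_gt_1[OF D_irrational])
  have "\<theta> (Suc (Suc n)) = of_int (partial_quotient D (Suc n)) * \<theta> (Suc n) + \<theta> n"
    by (simp add: \<theta>_def P_rec Q_rec algebra_simps)
  also have "\<dots> = (of_int (partial_quotient D (Suc n)) - ?c) * \<theta> (Suc n)"
    using Suc by (simp add: algebra_simps del: complete_quotient.simps)
  also have "\<dots> = - (1 / ?c') * \<theta> (Suc n)"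
    using complete_quotient_unfold[of D "Suc n"] by simp
  finally show ?case using c' by (simp del: complete_quotient.simps)
qed

text \<open>By the preceding lemma \<open>\<theta> n = - z \<theta> (n + 1)\<close> with a complete quotient \<open>z > 0\<close>: the
  convergents lie on alternate sides of \<open>D\<close>.\<close>

lemma \<theta>_alternates: "\<theta> n * \<theta> (Suc n) < 0"
proof -
  have c: "0 < complete_quotient D (Suc n)" for n
    using complete_quotient_Suc_gt_1[OF D_irrational, of n] by linarith
  have "\<theta> n \<noteq> 0" for n
  proof (induction n)
    case (Suc n)
    then show ?case using \<theta>_step[of n] by auto
  qed (simp add: \<theta>_def P_0 Q_0)
  then have "0 < (\<theta> (Suc n))\<^sup>2 * complete_quotient D (Suc n)"
    using c by (intro mult_pos_pos) auto
  moreover have "\<theta> n * \<theta> (Suc n) = - ((\<theta> (Suc n))\<^sup>2 * complete_quotient D (Suc n))"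
    using \<theta>_step[of n] by (simp add: power2_eq_square algebra_simps del: complete_quotient.simps)
  ultimately show ?thesis by linarith
qed

text \<open>For \<open>\<alpha> = x + D y\<close> and \<open>\<beta> = P + D Q\<close> with conjugates \<open>\<alpha>'\<close>, \<open>\<beta>'\<close>, the identity
  \<open>\<alpha> \<beta>' - \<alpha>' \<beta> = 2 D (y P - x Q)\<close> bounds the right-hand side by \<open>2 \<bar>\<alpha> \<alpha>'\<bar>\<close> as soon as
  \<open>\<beta> \<le> \<alpha>\<close> and \<open>\<bar>\<beta>'\<bar> \<le> \<bar>\<alpha>'\<bar>\<close>. As \<open>\<alpha> \<alpha>'\<close> is the norm of \<open>(x, y)\<close>, a norm below \<open>D\<close>
  forces \<open>y P = x Q\<close>.\<close>

lemma small_norm_is_convergent: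
  assumes x: "0 \<le> x" and y: "0 < y" and co: "coprime x y"
    and small: "\<bar>of_int (x\<^sup>2 - int d * y\<^sup>2)\<bar> < D"
  shows "\<exists>n\<ge>1. x = P n \<and> y = Q n"
proof -
  define \<alpha> where "\<alpha> = of_int x + D * of_int y"
  define \<alpha>' where "\<alpha>' = of_int x - D * of_int y"
  have norm: "of_int (x\<^sup>2 - int d * y\<^sup>2) = \<alpha> * \<alpha>'"
    by (simp add: \<alpha>_def \<alpha>'_def algebra_simps power2_eq_square)
  have "D * 1 \<le> D * of_int y" using y D_gt_1 by (intro mult_left_mono) auto
  moreover have "0 \<le> real_of_int x" using x by simp
  ultimately have \<alpha>1: "1 < \<alpha>" using D_gt_1 unfolding \<alpha>_def by linarith
  have ex: "\<exists>k. \<alpha> < W k"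
  proof -
    have "\<alpha> < W (nat \<lceil>\<alpha>\<rceil>)" using W_ge[of "nat \<lceil>\<alpha>\<rceil>"] by linarith
    then show ?thesis ..
  qed
  define k where "k = (LEAST k. \<alpha> < W k)"
  have k: "\<alpha> < W k" unfolding k_def using ex by (rule LeastI_ex)
  have "k \<noteq> 0" using k \<alpha>1 by (intro notI) (simp add: W_def P_0 Q_0)
  then obtain n where n: "k = Suc n" by (cases k) auto
  have lo: "W n \<le> \<alpha>" using not_less_Least[of n "\<lambda>k. \<alpha> < W k"] n by (simp flip: k_def)
  have hi: "\<alpha> < W (Suc n)" using k n by simp
  have W0: "0 < W n" "0 < W (Suc n)" using W_ge[of n] W_ge[of "Suc n"] by linarith+
  \<comment> \<open>Coordinates in the basis of two consecutive convergents, by Cramer's rule.\<close>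
  define \<epsilon> :: int where "\<epsilon> = (-1) ^ Suc n"
  have \<epsilon>: "\<epsilon> * \<epsilon> = 1" by (simp add: \<epsilon>_def flip: power_mult_distrib)
  have det: "P (Suc n) * Q n - P n * Q (Suc n) = \<epsilon>" using PQ_det \<epsilon>_def by simp
  define s where "s = \<epsilon> * (y * P (Suc n) - x * Q (Suc n))"
  define t where "t = \<epsilon> * (x * Q n - y * P n)"
  have "s * P n + t * P (Suc n) = \<epsilon> * x * (P (Suc n) * Q n - P n * Q (Suc n))"
    by (simp add: s_def t_def algebra_simps)
  then have xe: "x = s * P n + t * P (Suc n)" using \<epsilon> det by simp
  have "s * Q n + t * Q (Suc n) = \<epsilon> * y * (P (Suc n) * Q n - P n * Q (Suc n))"
    by (simp add: s_def t_def algebra_simps)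
  then have ye: "y = s * Q n + t * Q (Suc n)" using \<epsilon> det by simp
  have \<alpha>e: "\<alpha> = of_int s * W n + of_int t * W (Suc n)"
    unfolding \<alpha>_def W_def xe ye by (simp add: algebra_simps)
  have \<alpha>'e: "\<alpha>' = of_int s * \<theta> n + of_int t * \<theta> (Suc n)"
    unfolding \<alpha>'_def \<theta>_def xe ye by (simp add: algebra_simps)
  have "t = 0"
  proof (rule ccontr)
    assume t: "t \<noteq> 0"
    have Wt: "W (Suc n) \<le> of_int t * W (Suc n)" if "0 < t"
      using that W0 by (simp add: mult_le_cancel_right1)
    consider "0 < t" "0 \<le> s" | "t < 0" "s \<le> 0" | "s * t < 0"
      using t by (metis linorder_neqE_linordered_idom mult_neg_pos mult_pos_neg not_le)
    then show False
    proof cases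
      case 1
      then have "0 \<le> of_int s * W n" using W0 by simp
      then show False using Wt[OF 1(1)] hi \<alpha>e by linarith
    next
      case 2
      then have "of_int s * W n \<le> 0" "of_int t * W (Suc n) \<le> 0"
        using W0 by (auto simp: mult_nonpos_nonneg)
      then show False using \<alpha>e \<alpha>1 by linarith
    next
      case 3
      have "0 < of_int (s * t) * (\<theta> n * \<theta> (Suc n))"
        using 3 \<theta>_alternates[of n] by (intro mult_neg_neg) (simp_all only: of_int_less_0_iff)
      then have same: "0 < (of_int s * \<theta> n) * (of_int t * \<theta> (Suc n))"
        by (simp add: ac_simps)
      \<comment> \<open>Opposite signs of the coefficients cancel those of the conjugates, so that
        no cancellation occurs in the conjugate of \<open>\<alpha>\<close>.\<close>
      have "1 \<le> \<bar>s\<bar>" using 3 by (cases "s = 0") auto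
      then have "1 * \<bar>\<theta> n\<bar> \<le> \<bar>of_int s\<bar> * \<bar>\<theta> n\<bar>"
        by (intro mult_right_mono) linarith+
      also have "\<dots> = \<bar>of_int s * \<theta> n\<bar>" by (simp add: abs_mult)
      also have "\<dots> \<le> \<bar>\<alpha>'\<bar>"
        using same unfolding \<alpha>'e by (auto simp only: zero_less_mult_iff[of "of_int s * \<theta> n"])
      finally have le: "\<bar>\<theta> n\<bar> \<le> \<bar>\<alpha>'\<bar>" by simp
      have "1 \<le> \<bar>y * P n - x * Q n\<bar>" using t by (auto simp: t_def)
      then have "2 * D * 1 \<le> 2 * D * \<bar>of_int (y * P n - x * Q n)\<bar>"
        using D_gt_1 by (intro mult_left_mono) linarith+
      also have "\<dots> = \<bar>\<alpha> * \<theta> n - \<alpha>' * W n\<bar>"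
      proof -
        have "\<alpha> * \<theta> n - \<alpha>' * W n = 2 * D * of_int (y * P n - x * Q n)"
          by (simp add: \<alpha>_def \<alpha>'_def \<theta>_def W_def algebra_simps)
        then show ?thesis using D_gt_1 by (simp add: abs_mult)
      qed
      also have "\<dots> \<le> \<bar>\<alpha> * \<theta> n\<bar> + \<bar>\<alpha>' * W n\<bar>" by linarith
      also have "\<dots> \<le> \<alpha> * \<bar>\<alpha>'\<bar> + \<bar>\<alpha>'\<bar> * \<alpha>"
        unfolding abs_mult using le lo \<alpha>1 W0 by (intro add_mono mult_mono) auto
      also have "\<dots> = 2 * \<bar>of_int (x\<^sup>2 - int d * y\<^sup>2)\<bar>"
        unfolding norm using \<alpha>1 by (simp add: abs_mult)
      finally show False using small by simp
    qed
  qed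
  then have xy: "x = s * P n" "y = s * Q n" using xe ye by simp_all
  then have "s dvd 1" using co by (metis coprime_common_divisor dvd_triv_left)
  moreover have "0 < s"
    using xy(2) y PQ_pos[of n] by (metis mult_nonpos_nonneg not_less)
  ultimately have "s = 1" by (simp add: zdvd1_eq)
  then have "x = P n" "y = Q n" using xy by simp_all
  moreover have "n \<noteq> 0" using \<open>y = Q n\<close> y Q_0 by (intro notI) simp
  ultimately show ?thesis by (intro exI[of _ n]) auto
qed

lemma primitive_solutions_eq:
  assumes "of_int \<bar>m\<bar> < D"
  shows "primitive_solutions d m = {(P n, Q n) | n. 1 \<le> n \<and> (-1) ^ n * V n = m}"
proof (intro set_eqI iffI)
  fix w assume "w \<in> primitive_solutions d m"
  then obtain x y where w: "w = (x, y)" and x: "0 \<le> x" and y: "0 \<le> y"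
    and eq: "x\<^sup>2 - int d * y\<^sup>2 = m"
    and nt: "\<not> trivial_solution m (x, y)" and co: "gcd x y = 1"
    by (auto simp: primitive_solutions_def pell_solutions_def)
  have "y \<noteq> 0" using nt eq x by (auto simp: trivial_solution_def)
  with y have "0 < y" by simp
  moreover have "coprime x y" using co by (simp only: coprime_iff_gcd_eq_1)
  moreover have "\<bar>of_int (x\<^sup>2 - int d * y\<^sup>2)\<bar> < D" using assms unfolding eq by simp
  ultimately obtain n where "1 \<le> n" "x = P n" "y = Q n"
    using small_norm_is_convergent[OF x] by blast
  then show "w \<in> {(P n, Q n) | n. 1 \<le> n \<and> (-1) ^ n * V n = m}"
    using eq norm_convergent[of n] w by auto
next
  fix w assume "w \<in> {(P n, Q n) | n. 1 \<le> n \<and> (-1) ^ n * V n = m}"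
  then obtain n where w: "w = (P n, Q n)" and n: "1 \<le> n" and m: "(-1) ^ n * V n = m"
    by auto
  obtain k where k: "n = Suc k" using n by (cases n) auto
  have pos: "0 < P n" "0 < Q n" using PQ_pos[of k] k by auto
  have "gcd (P n) (Q n) dvd (-1) ^ Suc n"
    unfolding PQ_det[of n, symmetric] by simp
  moreover have "(-1 :: int) ^ Suc n dvd 1" by (simp add: minus_one_power_iff)
  ultimately have "gcd (P n) (Q n) dvd 1" by (rule dvd_trans)
  then have "gcd (P n) (Q n) = 1" by simp
  then show "w \<in> primitive_solutions d m"
    using pos m norm_convergent[of n] w
    by (auto simp: primitive_solutions_def pell_solutions_def trivial_solution_def)
qed

lemma conv_eq:
  assumes "1 \<le> n"
  shows "conv_num D (n - 1) = P n" "conv_denom D (n - 1) = Q n"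
  using assms by (simp_all add: conv_num_def conv_denom_def P_def Q_def)

lemma pell_solutions_infinite:
  assumes "n \<ge> 1" "(-1) ^ n * V n = m"
  shows "infinite (pell_solutions d m)"
proof -
  define f where "f k = (P (n + (2 * k) * sqrt_period d), Q (n + (2 * k) * sqrt_period d))" for k
  have "inj f"
  proof (rule injI)
    fix j k assume "f j = f k"
    then have "W (n + (2 * j) * sqrt_period d) = W (n + (2 * k) * sqrt_period d)"
      by (simp add: f_def W_def)
    then show "j = k"
      using strict_mono_eq[OF W_strict_mono] sqrt_period_ge_1 by simp
  qed
  moreover have "f k \<in> pell_solutions d m" for k
    using norm_convergent[of "n + (2 * k) * sqrt_period d"] V_period_mult[OF assms(1), of "2 * k"]
      PQ_pos[of "n + (2 * k) * sqrt_period d"] assms(2)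
    by (simp add: f_def pell_solutions_def power_add power_mult)
  ultimately show ?thesis
    using finite_subset[of "range f"] finite_imageD[of f UNIV] by auto
qed

lemma index_decomposition:
  assumes "1 \<le> n"
  obtains N k where "N \<in> {1..sqrt_period d}" "n = N + k * sqrt_period d"
proof
  let ?T = "sqrt_period d"
  have T: "0 < ?T" using sqrt_period_ge_1 by simp
  show "(n - 1) mod ?T + 1 \<in> {1..?T}" using T by (simp add: Suc_le_eq)
  show "n = (n - 1) mod ?T + 1 + (n - 1) div ?T * ?T"
    using assms mod_div_mult_eq[of "n - 1" ?T] by simp
qed

end

theorem mainTheorem1:
  fixes d :: nat and m :: int and T :: nat and p q :: "nat \<Rightarrow> int"
  assumes "\<not> (\<exists>k::nat. d = k\<^sup>2)"
    and "1 \<le> \<bar>m\<bar>" and "real_of_int \<bar>m\<bar> < sqrt (real d)"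
  defines "T \<equiv> sqrt_period d"
    and "p \<equiv> conv_num (sqrt (real d))"
    and "q \<equiv> conv_denom (sqrt (real d))"
  shows
    "(even T \<longrightarrow>
        (primitive_solutions d m \<noteq> {} \<longleftrightarrow> index_set d m \<noteq> {}) \<and>
        (primitive_solutions d m \<noteq> {} \<longrightarrow>
          primitive_solutions d m =
            (\<Union>N\<in>index_set d m. {(p (N + k * T - 1), q (N + k * T - 1)) | k. True}))) \<and>
     (odd T \<longrightarrow>
        (primitive_solutions d m \<noteq> {} \<longleftrightarrow> index_set d m \<noteq> {} \<or> index_set d (- m) \<noteq> {}) \<and>
        (primitive_solutions d m \<noteq> {} \<longrightarrow>
          primitive_solutions d m =
            (\<Union>N\<in>index_set d m.
               {(p (N + 2 * k * T - 1), q (N + 2 * k * T - 1)) | k. True}) \<union>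
            (\<Union>M\<in>index_set d (- m).
               {(p (M + (2 * k + 1) * T - 1), q (M + (2 * k + 1) * T - 1)) | k. True}))) \<and>
     (primitive_solutions d m \<noteq> {} \<longrightarrow> infinite (pell_solutions d m))"
proof -
  interpret nonsquare d by unfold_locales (rule assms(1))
  let ?S = "{(P n, Q n) | n. 1 \<le> n \<and> (-1) ^ n * V n = m}"
  have S: "primitive_solutions d m = ?S"
    by (rule primitive_solutions_eq[OF assms(3)])
  have index: "N \<in> index_set d l \<longleftrightarrow> N \<in> {1..T} \<and> (-1) ^ N * V N = l" for N l
    by (simp add: index_set_def sqrt_v_eq_V T_def)
  have pq: "(p (N + k * T - 1), q (N + k * T - 1)) = (P (N + k * T), Q (N + k * T))"
    if "N \<in> index_set d l" for N l k
    using that conv_eq[of "N + k * T"] by (simp add: index p_def q_def)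
  have V_add: "V (N + k * T) = V N" if "1 \<le> N" for N k
    using V_period_mult[OF that] by (simp add: T_def)
  have even_case: "?S = (\<Union>N\<in>index_set d m. {(p (N + k * T - 1), q (N + k * T - 1)) | k. True})"
    (is "_ = ?R") if T: "even T"
  proof (intro set_eqI iffI)
    have sign: "(-1 :: int) ^ (N + k * T) = (-1) ^ N" for N k
      using T by (simp add: power_add)
    fix w
    {
      assume "w \<in> ?S"
      then obtain n where n: "1 \<le> n" "(-1) ^ n * V n = m" and w: "w = (P n, Q n)" by auto
      obtain N k where N: "N \<in> {1..T}" and nk: "n = N + k * T"
        using index_decomposition[OF n(1)] unfolding T_def by blast
      have "N \<in> index_set d m"
        using n(2) N V_add[of N k] by (simp add: index nk sign)
      then show "w \<in> ?R" unfolding w nk pq[OF \<open>N \<in> index_set d m\<close>, symmetric] by blast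
    next
      assume "w \<in> ?R"
      then obtain N k where N: "N \<in> index_set d m"
        and "w = (p (N + k * T - 1), q (N + k * T - 1))" by blast
      then have w: "w = (P (N + k * T), Q (N + k * T))" using pq by simp
      have "1 \<le> N + k * T \<and> (-1) ^ (N + k * T) * V (N + k * T) = m"
        using N V_add[of N k] by (simp add: index sign)
      then show "w \<in> ?S" using w by blast
    }
  qed
  have odd_case: "?S =
      (\<Union>N\<in>index_set d m. {(p (N + 2 * k * T - 1), q (N + 2 * k * T - 1)) | k. True}) \<union>
      (\<Union>M\<in>index_set d (- m).
         {(p (M + (2 * k + 1) * T - 1), q (M + (2 * k + 1) * T - 1)) | k. True})"
    (is "_ = ?R1 \<union> ?R2") if T: "odd T"
  proof (intro set_eqI iffI)
    have sign: "(-1 :: int) ^ (N + k * T) = (-1) ^ N * (-1) ^ k" for N k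
      using T by (simp add: power_add mult.commute[of k] power_mult)
    fix w
    {
      assume "w \<in> ?S"
      then obtain n where n: "1 \<le> n" "(-1) ^ n * V n = m" and w: "w = (P n, Q n)" by auto
      obtain N k where N: "N \<in> {1..T}" and nk: "n = N + k * T"
        using index_decomposition[OF n(1)] unfolding T_def by blast
      have val: "(-1) ^ N * (-1) ^ k * V N = m"
        using n(2) N V_add[of N k] by (simp add: nk sign)
      show "w \<in> ?R1 \<union> ?R2"
      proof (cases "even k")
        case True
        then obtain j where k: "k = 2 * j" by blast
        then have "N \<in> index_set d m" using val N by (simp add: index)
        then show ?thesis
          unfolding w nk k pq[OF \<open>N \<in> index_set d m\<close>, symmetric] by blast
      next
        case False
        then obtain j where k: "k = 2 * j + 1" by (rule oddE)
        then have "N \<in> index_set d (- m)" using val N by (auto simp: index)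
        then show ?thesis
          unfolding w nk k pq[OF \<open>N \<in> index_set d (- m)\<close>, symmetric] by blast
      qed
    next
      assume "w \<in> ?R1 \<union> ?R2"
      then obtain N k where N: "1 \<le> N" "(-1) ^ N * (-1) ^ k * V N = m"
        and w: "w = (P (N + k * T), Q (N + k * T))"
      proof
        assume "w \<in> ?R1"
        then obtain N j where "N \<in> index_set d m"
          and "w = (p (N + 2 * j * T - 1), q (N + 2 * j * T - 1))" by blast
        moreover from this
        have "w = (P (N + 2 * j * T), Q (N + 2 * j * T))" using pq by simp
        ultimately show ?thesis
          by (intro that[of N "2 * j"]) (simp_all only: index, auto)
      next
        assume "w \<in> ?R2"
        then obtain N j where "N \<in> index_set d (- m)"
          and "w = (p (N + (2 * j + 1) * T - 1), q (N + (2 * j + 1) * T - 1))" by blast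
        moreover from this
        have "w = (P (N + (2 * j + 1) * T), Q (N + (2 * j + 1) * T))" using pq by metis
        ultimately show ?thesis
          by (intro that[of N "2 * j + 1"]) (simp_all only: index, auto)
      qed
      then have "1 \<le> N + k * T \<and> (-1) ^ (N + k * T) * V (N + k * T) = m"
        using V_add[of N k] by (simp add: sign)
      then show "w \<in> ?S" using w by blast
    }
  qed
  have even_iff: "?S \<noteq> {} \<longleftrightarrow> index_set d m \<noteq> {}" if "even T"
    unfolding even_case[OF that] by blast
  have odd_iff: "?S \<noteq> {} \<longleftrightarrow> index_set d m \<noteq> {} \<or> index_set d (- m) \<noteq> {}" if "odd T"
    unfolding odd_case[OF that] by blast
  have inf: "infinite (pell_solutions d m)" if "?S \<noteq> {}"
    using that pell_solutions_infinite by blast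
  show ?thesis
    unfolding S
    by (intro conjI impI) (rule even_iff odd_iff even_case odd_case inf; assumption)+
qed

end
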